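(* Let $f:\mathbb{Z}^n\to\mathbb{R}\cup\{+\infty\}$, let $\alpha$ be a positive integer, and define $f^\alpha:\mathbb{Z}^n\to\mathbb{R}\cup\{+\infty\}$ by $f^\alpha(x)=f(\alpha x)$. (1) If $f$ is globally discrete midpoint convex, then $f^\alpha$ is globally discrete midpoint convex. (2) If $f$ is locally discrete midpoint convex, then $f^\alpha$ is locally discrete midpoint convex.
   Context: For $x\in\mathbb{R}^n$, $\lceil x\rceil$ and $\lfloor x\rfloor$ denote the integer vectors obtained by rounding each component up, respectively down. The effective domain of $f:\mathbb{Z}^n\to\mathbb{R}\cup\{+\infty\}$ is $\operatorname{dom} f=\{x\in\mathbb{Z}^n\mid f(x)<+\infty\}$. A set $S\subseteq\mathbb{Z}^n$ is discrete midpoint convex if for all $x,y\in S$ with $\|x-y\|_\infty\ge2$ both $\lceil (x+y)/2\rceil$ and $\lfloor (x+y)/2\rfloor$ belong to $S$. Discrete midpoint convexity inequality for a pair $(x,y)$: $f(x)+f(y)\ge f(\lceil (x+y)/2\rceil)+f(\lfloor (x+y)/2\rfloor)$. $f$ is globally discrete midpoint convex if this inequality holds for all $x,y\in\mathbb{Z}^n$ with $\|x-y\|_\infty\ge2$. $f$ is locally discrete midpoint convex if $\operatorname{dom} f$ is a discrete midpoint convex set and the inequality holds for all $x,y\in\mathbb{Z}^n$ with $\|x-y\|_\infty=2$. *)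

theory Defs
  imports "HOL-Analysis.Analysis"
begin

definition real_vec :: "int ^ 'n \<Rightarrow> real ^ 'n" where
  "real_vec x = (\<chi> i. real_of_int (x $ i))"

definition ceiling_vec :: "real ^ 'n \<Rightarrow> int ^ 'n" where
  "ceiling_vec x = (\<chi> i. \<lceil>x $ i\<rceil>)"

definition floor_vec :: "real ^ 'n \<Rightarrow> int ^ 'n" where
  "floor_vec x = (\<chi> i. \<lfloor>x $ i\<rfloor>)"

definition linf_dist :: "int ^ 'n \<Rightarrow> int ^ 'n \<Rightarrow> real" where
  "linf_dist x y = infnorm (real_vec x - real_vec y)"

definition dmc_set :: "(int ^ 'n) set \<Rightarrow> bool" where
  "dmc_set S \<longleftrightarrow>
    (\<forall>x\<in>S. \<forall>y\<in>S. linf_dist x y \<ge> 2 \<longrightarrow>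
      ceiling_vec (midpoint (real_vec x) (real_vec y)) \<in> S \<and>
      floor_vec (midpoint (real_vec x) (real_vec y)) \<in> S)"

(* Functions into the reals extended by +\<infinity> are rendered as ereal-valued functions;
   the theorem using these notions excludes the value -\<infinity>, so that the
   ereal sums below are the usual ones. *)

definition effective_dom :: "(int ^ 'n \<Rightarrow> ereal) \<Rightarrow> (int ^ 'n) set" where
  "effective_dom f = {x. f x < \<infinity>}"

definition dmc_ineq :: "(int ^ 'n \<Rightarrow> ereal) \<Rightarrow> int ^ 'n \<Rightarrow> int ^ 'n \<Rightarrow> bool" where
  "dmc_ineq f x y \<longleftrightarrow>
    f x + f y \<ge> f (ceiling_vec (midpoint (real_vec x) (real_vec y))) +
                f (floor_vec (midpoint (real_vec x) (real_vec y)))"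

definition globally_dmc :: "(int ^ 'n \<Rightarrow> ereal) \<Rightarrow> bool" where
  "globally_dmc f \<longleftrightarrow> (\<forall>x y. linf_dist x y \<ge> 2 \<longrightarrow> dmc_ineq f x y)"

definition locally_dmc :: "(int ^ 'n \<Rightarrow> ereal) \<Rightarrow> bool" where
  "locally_dmc f \<longleftrightarrow>
    dmc_set (effective_dom f) \<and> (\<forall>x y. linf_dist x y = 2 \<longrightarrow> dmc_ineq f x y)"

definition scaled :: "int \<Rightarrow> (int ^ 'n \<Rightarrow> ereal) \<Rightarrow> int ^ 'n \<Rightarrow> ereal" where
  "scaled \<alpha> f x = f (\<alpha> *s x)"

end

theory Submission imports Defs "HOL-Library.Multiset" begin

text \<open>Fix \<open>x\<close>, \<open>y\<close> at distance at least \<open>2\<close>, and let \<open>u\<close> and \<open>v\<close> be \<open>(y - x) / 2\<close> rounded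
  down and up, so that \<open>u + v = y - x\<close>. Rounded midpoints commute with integer translations; hence
  for \<^emph>\<open>every\<close> integer point \<open>z\<close> the pair \<open>z\<close>, \<open>z + u + v\<close> is at the same distance as \<open>x\<close>, \<open>y\<close> and
  has the rounded midpoints \<open>z + u\<close> and \<open>z + v\<close>. Put \<open>P s t = \<alpha> x + s u + t v\<close>. On each unit
  square of the grid \<open>0 \<le> s, t \<le> \<alpha>\<close> the midpoint inequality compares the two diagonals,
  \<open>f (P s (t+1)) + f (P (s+1) t) \<le> f (P s t) + f (P (s+1) (t+1))\<close>.
  The corners of the whole grid are \<open>\<alpha> x\<close> and \<open>\<alpha> y\<close> on one diagonal and \<open>\<alpha>\<close> times the rounded
  midpoints of \<open>x\<close> and \<open>y\<close> on the other, so the sum of these inequalities over all unit squares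
  telescopes to the inequality for the scaled function. Only pairs at the distance of
  \<open>x\<close> and \<open>y\<close> occur, and this is why the argument serves the global and the local notion alike.

  The cancellation requires \<open>f\<close> to be finite on the grid when it is finite at \<open>\<alpha> x\<close> and \<open>\<alpha> y\<close>
  (\<open>dmc_set_grid\<close>). Midpoint convexity of the domain fills the grid once
  its diagonal, the points \<open>\<alpha> x + i (y - x)\<close>, lies in the domain. These are integer points on the
  segment from \<open>\<alpha> x\<close> to \<open>\<alpha> y\<close>, and a discrete midpoint convex set contains every integer
  point that is the mean of finitely many of its elements (\<open>dmc_set_mean_mem\<close>): replacing a
  distant pair among the elements by its rounded midpoints preserves the sum and lowers the sum of
  squares, and when no distant pair is left, integrality of the mean forces all the elements to
  coincide with it.\<close>

section \<open>Rounded midpoints of integer vectors\<close>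

definition up_mid :: "int ^ 'n \<Rightarrow> int ^ 'n \<Rightarrow> int ^ 'n" where
  "up_mid x y = ceiling_vec (midpoint (real_vec x) (real_vec y))"

definition down_mid :: "int ^ 'n \<Rightarrow> int ^ 'n \<Rightarrow> int ^ 'n" where
  "down_mid x y = floor_vec (midpoint (real_vec x) (real_vec y))"

lemma down_mid_nth: "down_mid x y $ i = (x $ i + y $ i) div 2"
proof -
  have "down_mid x y $ i = \<lfloor>real_of_int (x $ i + y $ i) / real_of_int 2\<rfloor>"
    by (simp add: down_mid_def floor_vec_def midpoint_def real_vec_def field_simps)
  then show ?thesis
    by (simp only: floor_divide_of_int_eq)
qed

lemma up_mid_nth: "up_mid x y $ i = (x $ i + y $ i + 1) div 2"
proof -
  have "up_mid x y $ i = \<lceil>real_of_int (x $ i + y $ i) / real_of_int 2\<rceil>"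
    by (simp add: up_mid_def ceiling_vec_def midpoint_def real_vec_def field_simps)
  also have "\<dots> = - (- (x $ i + y $ i) div 2)"
    by (simp only: ceiling_divide_eq_div)
  also have "\<dots> = (x $ i + y $ i + 1) div 2"
    by presburger
  finally show ?thesis .
qed

lemma up_mid_plus_down_mid: "up_mid x y + down_mid x y = x + y"
proof -
  have "(a + 1) div 2 + a div 2 = a" for a :: int
    by presburger
  then show ?thesis
    by (simp add: vec_eq_iff up_mid_nth down_mid_nth)
qed

corollary up_mid_eq: "up_mid x y = x + y - down_mid x y"
  using up_mid_plus_down_mid[of x y] by (simp add: eq_diff_eq)

lemma mid_translate:
  shows up_mid_translate: "up_mid z (z + (y - x)) = z + (up_mid x y - x)"
    and down_mid_translate: "down_mid z (z + (y - x)) = z + (down_mid x y - x)"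
proof -
  have "(a + (a + (c - b)) + 1) div 2 = a + ((b + c + 1) div 2 - b)"
    and "(a + (a + (c - b))) div 2 = a + ((b + c) div 2 - b)" for a b c :: int
    by presburger+
  then show "up_mid z (z + (y - x)) = z + (up_mid x y - x)"
    and "down_mid z (z + (y - x)) = z + (down_mid x y - x)"
    by (simp_all add: vec_eq_iff up_mid_nth down_mid_nth)
qed

lemma linf_dist_translate: "linf_dist z (z + (y - x)) = linf_dist x y"
proof -
  have "real_vec z - real_vec (z + (y - x)) = real_vec x - real_vec y"
    by (simp add: vec_eq_iff real_vec_def)
  then show ?thesis
    by (simp add: linf_dist_def)
qed

lemma linf_dist_ge_2_iff:
  fixes x y :: "int ^ 'n"
  shows "2 \<le> linf_dist x y \<longleftrightarrow> (\<exists>i. 2 \<le> \<bar>x $ i - y $ i\<bar>)"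
proof -
  have "2 \<le> linf_dist x y \<longleftrightarrow> (\<exists>i. (2::real) \<le> \<bar>real_of_int (x $ i) - real_of_int (y $ i)\<bar>)"
    by (simp add: linf_dist_def infnorm_Max Max_ge_iff Basis_vec_def inner_axis real_vec_def)
  also have "\<dots> \<longleftrightarrow> (\<exists>i. 2 \<le> \<bar>x $ i - y $ i\<bar>)"
    by (intro ex_cong1) linarith
  finally show ?thesis .
qed

section \<open>Discrete midpoint convex sets have no holes\<close>

lemma dmc_setD:
  assumes "dmc_set S" "x \<in> S" "y \<in> S" "2 \<le> linf_dist x y"
  shows "up_mid x y \<in> S" "down_mid x y \<in> S"
  using assms by (auto simp: dmc_set_def up_mid_def down_mid_def)

text \<open>By the parallelogram law it suffices to compare the squared norms of the differences. The
  rounded midpoints differ by \<open>0\<close> or \<open>1\<close> in each coordinate, and by \<open>1\<close> exactly where \<open>x - y\<close> is odd.\<close>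

lemma sum_squares_mid_less:
  fixes x y :: "int ^ 'n"
  assumes "2 \<le> linf_dist x y"
  shows "(\<Sum>i\<in>UNIV. (up_mid x y $ i)\<^sup>2) + (\<Sum>i\<in>UNIV. (down_mid x y $ i)\<^sup>2)
    < (\<Sum>i\<in>UNIV. (x $ i)\<^sup>2) + (\<Sum>i\<in>UNIV. (y $ i)\<^sup>2)"
proof -
  obtain k where k: "2 \<le> \<bar>x $ k - y $ k\<bar>"
    using assms linf_dist_ge_2_iff by blast
  have *: "2 * (a\<^sup>2 + b\<^sup>2) - 2 * (((a + b + 1) div 2)\<^sup>2 + ((a + b) div 2)\<^sup>2)
      = (a - b)\<^sup>2 - (a - b) mod 2" for a b :: int
  proof (cases "even (a - b)")
    case True
    then obtain c where "a = b + 2 * c"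
      by (metis add.commute diff_add_cancel evenE)
    then have "(a + b + 1) div 2 = b + c" "(a + b) div 2 = b + c" "(a - b) mod 2 = 0"
      by auto
    then show ?thesis
      using \<open>a = b + 2 * c\<close> by (simp add: power2_eq_square algebra_simps)
  next
    case False
    then obtain c where "a = b + 2 * c + 1"
      by (metis add.assoc add.commute diff_add_cancel oddE)
    then have "(a + b + 1) div 2 = b + c + 1" "(a + b) div 2 = b + c" "(a - b) mod 2 = 1"
      by auto
    then show ?thesis
      using \<open>a = b + 2 * c + 1\<close> by (simp add: power2_eq_square algebra_simps)
  qed
  have mod_le: "c mod 2 \<le> \<bar>c\<bar>" for c :: int
    by presburger
  have abs_le: "\<bar>c\<bar> \<le> c\<^sup>2" for c :: int
    using mult_left_mono[of 1 "\<bar>c\<bar>" "\<bar>c\<bar>"] by (cases "c = 0") (auto simp: power2_eq_square)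
  have halve: "2 * p - 2 * q = r - m \<Longrightarrow> m \<le> r \<Longrightarrow> q \<le> p"
    "2 * p - 2 * q = r - m \<Longrightarrow> m < r \<Longrightarrow> q < p" for p q r m :: int
    by linarith+
  have le: "((a + b + 1) div 2)\<^sup>2 + ((a + b) div 2)\<^sup>2 \<le> a\<^sup>2 + b\<^sup>2" for a b :: int
    using order_trans[OF mod_le abs_le, of "a - b"] *[of a b] halve(1) by blast
  \<comment> \<open>A coordinate difference of absolute value \<open>1\<close> gives equality, so strictness comes from the
    coordinate \<open>k\<close>.\<close>
  have "(x $ k - y $ k) mod 2 < \<bar>x $ k - y $ k\<bar>"
    using k pos_mod_bound[of 2 "x $ k - y $ k"] by linarith
  then have less: "((x $ k + y $ k + 1) div 2)\<^sup>2 + ((x $ k + y $ k) div 2)\<^sup>2 < (x $ k)\<^sup>2 + (y $ k)\<^sup>2"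
    using order.strict_trans2[OF _ abs_le] *[of "x $ k" "y $ k"] halve(2) by blast
  have "(\<Sum>i\<in>UNIV. (up_mid x y $ i)\<^sup>2 + (down_mid x y $ i)\<^sup>2) < (\<Sum>i\<in>UNIV. (x $ i)\<^sup>2 + (y $ i)\<^sup>2)"
  proof (rule sum_strict_mono_ex1)
    show "\<forall>i\<in>UNIV. (up_mid x y $ i)\<^sup>2 + (down_mid x y $ i)\<^sup>2 \<le> (x $ i)\<^sup>2 + (y $ i)\<^sup>2"
      by (simp add: up_mid_nth down_mid_nth le)
    show "\<exists>i\<in>UNIV. (up_mid x y $ i)\<^sup>2 + (down_mid x y $ i)\<^sup>2 < (x $ i)\<^sup>2 + (y $ i)\<^sup>2"
      using less by (auto simp: up_mid_nth down_mid_nth)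
  qed simp
  then show ?thesis
    by (simp add: sum.distrib)
qed

lemma sum_mset_nth: "(\<Sum>\<^sub># M) $ i = (\<Sum>x\<in>#M. x $ i)"
  for M :: "(int ^ 'n) multiset"
  by (induction M) auto

text \<open>Elements that pairwise differ by at most \<open>1\<close> cannot lie on both sides of an integer, so if
  one of them missed the integer mean, the sum would be off in that direction.\<close>

lemma mset_eq_mean_if_close:
  fixes M :: "int multiset"
  assumes close: "\<And>a b. a \<in># M \<Longrightarrow> b \<in># M \<Longrightarrow> \<bar>a - b\<bar> \<le> 1"
    and mean: "\<Sum>\<^sub># M = int (size M) * c" and "a \<in># M"
  shows "a = c"
proof -
  obtain N where N: "M = add_mset a N"
    using \<open>a \<in># M\<close> by (metis insert_DiffM)
  have lower: "int (size N) * c \<le> \<Sum>\<^sub># N" if "\<And>b. b \<in># N \<Longrightarrow> c \<le> b" for N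
    using that by (induction N) (auto simp: algebra_simps intro: add_mono)
  have upper: "\<Sum>\<^sub># N \<le> int (size N) * c" if "\<And>b. b \<in># N \<Longrightarrow> b \<le> c" for N
    using that by (induction N) (auto simp: algebra_simps intro: add_mono)
  have sum: "a + \<Sum>\<^sub># N = c + int (size N) * c"
    using mean N by (simp add: algebra_simps)
  have near: "\<bar>a - b\<bar> \<le> 1" if "b \<in># N" for b
    using close that N by simp
  consider "a < c" | "a = c" | "c < a"
    by linarith
  then show ?thesis
  proof cases
    case 1
    then have "b \<le> c" if "b \<in># N" for b
      using near[OF that] by linarith
    then have "\<Sum>\<^sub># N \<le> int (size N) * c"
      by (rule upper)
    then show ?thesis
      using sum 1 by linarith
  next
    case 3
    then have "c \<le> b" if "b \<in># N" for b
      using near[OF that] by linarith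
    then have "int (size N) * c \<le> \<Sum>\<^sub># N"
      by (rule lower)
    then show ?thesis
      using sum 3 by linarith
  qed
qed

text \<open>The sum of squares strictly decreases under the replacement of a distant pair by its rounded
  midpoints, so it serves as the termination measure.\<close>

lemma dmc_set_mean_mem:
  fixes M :: "(int ^ 'n) multiset"
  assumes S: "dmc_set S"
    and "M \<noteq> {#}" "set_mset M \<subseteq> S" "\<Sum>\<^sub># M = int (size M) *s z"
  shows "z \<in> S"
  using assms(2-)
proof (induction "nat (\<Sum>x\<in>#M. \<Sum>i\<in>UNIV. (x $ i)\<^sup>2)" arbitrary: M rule: less_induct)
  case less
  show ?case
  proof (cases "\<exists>x\<in>#M. \<exists>y\<in>#M. 2 \<le> linf_dist x y")
    case True
    then obtain x y where xy: "x \<in># M" "y \<in># M" "2 \<le> linf_dist x y"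
      by blast
    then have "x \<noteq> y"
      by (auto simp: linf_dist_ge_2_iff)
    then obtain N where M: "M = add_mset x (add_mset y N)"
      using xy by (metis insert_DiffM insert_noteq_member)
    let ?M = "add_mset (up_mid x y) (add_mset (down_mid x y) N)"
    have nonneg: "0 \<le> (\<Sum>x\<in>#K. \<Sum>i\<in>UNIV. (x $ i)\<^sup>2)" for K :: "(int ^ 'n) multiset"
      by (induction K) (simp_all add: sum_nonneg)
    have "(\<Sum>x\<in>#?M. \<Sum>i\<in>UNIV. (x $ i)\<^sup>2) < (\<Sum>x\<in>#M. \<Sum>i\<in>UNIV. (x $ i)\<^sup>2)"
      using sum_squares_mid_less[OF xy(3)] by (simp add: M)
    then have smaller: "nat (\<Sum>x\<in>#?M. \<Sum>i\<in>UNIV. (x $ i)\<^sup>2) < nat (\<Sum>x\<in>#M. \<Sum>i\<in>UNIV. (x $ i)\<^sup>2)"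
      using nonneg[of ?M] by linarith
    show ?thesis
    proof (rule less.hyps[OF smaller])
      show "set_mset ?M \<subseteq> S"
        using dmc_setD[OF S _ _ xy(3)] less.prems(2) M by auto
      show "\<Sum>\<^sub># ?M = int (size ?M) *s z"
        using less.prems(3) up_mid_plus_down_mid[of x y] by (simp add: M add.assoc[symmetric])
    qed simp
  next
    case False
    have close: "\<bar>x $ i - y $ i\<bar> \<le> 1" if "x \<in># M" "y \<in># M" for x y i
    proof -
      have "\<not> 2 \<le> \<bar>x $ i - y $ i\<bar>"
        using False that linf_dist_ge_2_iff by blast
      then show ?thesis
        by linarith
    qed
    obtain x where x: "x \<in># M"
      using less.prems(1) by auto
    have "x $ i = z $ i" for i
    proof (rule mset_eq_mean_if_close)
      show "\<Sum>\<^sub># (image_mset (\<lambda>x. x $ i) M) = int (size (image_mset (\<lambda>x. x $ i) M)) * z $ i"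
        using less.prems(3) by (simp flip: sum_mset_nth)
    qed (use close x in auto)
    then have "x = z"
      by (simp add: vec_eq_iff)
    then show ?thesis
      using x less.prems(2) by blast
  qed
qed

text \<open>The point is the mean of \<open>n - i\<close> copies of one endpoint and \<open>i\<close> copies of the other.\<close>

lemma dmc_set_segment:
  assumes "dmc_set S" "x \<in> S" "x + int n *s w \<in> S" "i \<le> n"
  shows "x + int i *s w \<in> S"
proof (cases "n = 0")
  case True
  then show ?thesis
    using assms by simp
next
  case False
  let ?M = "replicate_mset (n - i) x + replicate_mset i (x + int n *s w)"
  show ?thesis
  proof (rule dmc_set_mean_mem[OF assms(1)])
    show "?M \<noteq> {#}"
      using False assms(4) by (cases "i = 0") (auto simp flip: size_eq_0_iff_empty)
    show "set_mset ?M \<subseteq> S"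
      using assms(2,3) by auto
    show "\<Sum>\<^sub># ?M = int (size ?M) *s (x + int i *s w)"
      using assms(4) by (simp add: vec_eq_iff of_nat_index algebra_simps of_nat_diff)
  qed
qed

section \<open>The grid between two scaled points\<close>

text \<open>The grid starts at \<open>\<alpha> x\<close>; its steps are the two roundings of \<open>(y - x) / 2\<close>.\<close>

definition grid_point :: "int ^ 'n \<Rightarrow> int ^ 'n \<Rightarrow> int \<Rightarrow> nat \<Rightarrow> nat \<Rightarrow> int ^ 'n" where
  "grid_point x y \<alpha> s t = \<alpha> *s x + int s *s (down_mid x y - x) + int t *s (up_mid x y - x)"

lemma grid_point_diagonal: "grid_point x y \<alpha> s s = \<alpha> *s x + int s *s (y - x)"
  by (simp add: grid_point_def up_mid_eq vec_eq_iff algebra_simps)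

lemma grid_point_corners:
  assumes "\<alpha> \<ge> 0"
  shows "grid_point x y \<alpha> 0 0 = \<alpha> *s x"
    and "grid_point x y \<alpha> (nat \<alpha>) (nat \<alpha>) = \<alpha> *s y"
    and "grid_point x y \<alpha> 0 (nat \<alpha>) = \<alpha> *s up_mid x y"
    and "grid_point x y \<alpha> (nat \<alpha>) 0 = \<alpha> *s down_mid x y"
  using assms grid_point_diagonal[of x y \<alpha> "nat \<alpha>"]
  by (simp_all add: grid_point_def vec_eq_iff algebra_simps)

lemma grid_point_opposite:
  "grid_point x y \<alpha> (Suc s) (Suc t) = grid_point x y \<alpha> s t + (y - x)"
  by (simp add: grid_point_def up_mid_eq vec_eq_iff algebra_simps)

text \<open>Every unit square is a translate of the square with the corners \<open>x\<close>, \<open>y\<close> and their rounded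
  midpoints.\<close>

lemma grid_point_square:
  fixes x y :: "int ^ 'n" and \<alpha> :: int
  defines "P \<equiv> grid_point x y \<alpha>"
  shows "linf_dist (P s t) (P (Suc s) (Suc t)) = linf_dist x y"
    and "up_mid (P s t) (P (Suc s) (Suc t)) = P s (Suc t)"
    and "down_mid (P s t) (P (Suc s) (Suc t)) = P (Suc s) t"
  unfolding P_def grid_point_opposite linf_dist_translate up_mid_translate down_mid_translate
  by (simp_all add: grid_point_def vec_eq_iff algebra_simps)

text \<open>Starting from the diagonal, which consists of integer points on a segment, the unit squares
  add the parallels \<open>\<bar>s - t\<bar> = d\<close> one \<open>d\<close> after another.\<close>

lemma dmc_set_grid:
  fixes S :: "(int ^ 'n) set"
  assumes S: "dmc_set S" and "\<alpha> \<ge> 0" and far: "2 \<le> linf_dist x y"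
    and x: "\<alpha> *s x \<in> S" and y: "\<alpha> *s y \<in> S"
    and "s \<le> nat \<alpha>" "t \<le> nat \<alpha>"
  shows "grid_point x y \<alpha> s t \<in> S"
proof -
  let ?P = "grid_point x y \<alpha>"
  have step: "?P i (Suc j) \<in> S \<and> ?P (Suc i) j \<in> S"
    if "?P i j \<in> S" "?P (Suc i) (Suc j) \<in> S" for i j
    using dmc_setD[OF S that] far by (simp add: grid_point_square)
  have "\<alpha> *s x + int (nat \<alpha>) *s (y - x) \<in> S"
    using y \<open>\<alpha> \<ge> 0\<close> by (simp flip: grid_point_diagonal add: grid_point_corners)
  then have diagonal: "?P i i \<in> S" if "i \<le> nat \<alpha>" for i
    unfolding grid_point_diagonal using dmc_set_segment[OF S x _ that] by blast
  have "?P i (i + d) \<in> S \<and> ?P (i + d) i \<in> S" if "i + d \<le> nat \<alpha>" for i d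
    using that
  proof (induction d arbitrary: i)
    case 0
    then show ?case
      using diagonal by simp
  next
    case (Suc d)
    then show ?case
      using Suc.IH[of i] Suc.IH[of "Suc i"] step[of i "i + d"] step[of "i + d" i] by simp
  qed
  from this[of s "t - s"] this[of t "s - t"] show ?thesis
    using assms(6,7) by (cases "s \<le> t") auto
qed

section \<open>Scaling\<close>

lemma rectangle_ineq_of_unit_squares:
  fixes F :: "nat \<Rightarrow> nat \<Rightarrow> real"
  assumes unit: "\<And>s t. s < m \<Longrightarrow> t < n \<Longrightarrow> F s (Suc t) + F (Suc s) t \<le> F s t + F (Suc s) (Suc t)"
  shows "F 0 n + F m 0 \<le> F 0 0 + F m n"
proof -
  have strip: "F s k + F (Suc s) 0 \<le> F s 0 + F (Suc s) k" if "s < m" "k \<le> n" for s k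
    using that(2)
  proof (induction k)
    case (Suc k)
    then show ?case
      using unit[of s k] that(1) by simp
  qed simp
  have "F 0 n + F k 0 \<le> F 0 0 + F k n" if "k \<le> m" for k
    using that
  proof (induction k)
    case (Suc k)
    then show ?case
      using strip[of k n] by simp
  qed simp
  then show ?thesis
    by blast
qed

text \<open>The inequality is assumed only for pairs at the distance of \<open>x\<close> and \<open>y\<close>: for the global notion
  that distance is any number at least \<open>2\<close>, for the local notion it is \<open>2\<close> itself.\<close>

lemma dmc_ineq_scaled:
  fixes f :: "int ^ 'n \<Rightarrow> ereal"
  assumes not_MInf: "\<And>x. f x \<noteq> -\<infinity>" and "\<alpha> \<ge> 0"
    and dom: "dmc_set (effective_dom f)" and far: "2 \<le> linf_dist x y"
    and ineq: "\<And>a b. linf_dist a b = linf_dist x y \<Longrightarrow> dmc_ineq f a b"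
  shows "dmc_ineq (scaled \<alpha> f) x y"
proof (cases "\<alpha> *s x \<in> effective_dom f \<and> \<alpha> *s y \<in> effective_dom f")
  case False
  then have "f (\<alpha> *s x) + f (\<alpha> *s y) = \<infinity>"
    by (auto simp: effective_dom_def)
  then show ?thesis
    unfolding dmc_ineq_def scaled_def by (simp only: ereal_less_eq(1))
next
  case True
  let ?P = "grid_point x y \<alpha>"
  define F where "F s t = real_of_ereal (f (?P s t))" for s t
  have F: "f (?P s t) = ereal (F s t)" if "s \<le> nat \<alpha>" "t \<le> nat \<alpha>" for s t
    using dmc_set_grid[OF dom \<open>\<alpha> \<ge> 0\<close> far _ _ that] True not_MInf[of "?P s t"]
    by (cases "f (?P s t)") (auto simp: F_def effective_dom_def)
  have "F 0 (nat \<alpha>) + F (nat \<alpha>) 0 \<le> F 0 0 + F (nat \<alpha>) (nat \<alpha>)"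
  proof (rule rectangle_ineq_of_unit_squares)
    fix s t assume st: "s < nat \<alpha>" "t < nat \<alpha>"
    have "dmc_ineq f (?P s t) (?P (Suc s) (Suc t))"
      by (simp add: ineq grid_point_square)
    then have "f (?P s (Suc t)) + f (?P (Suc s) t) \<le> f (?P s t) + f (?P (Suc s) (Suc t))"
      unfolding dmc_ineq_def up_mid_def[symmetric] down_mid_def[symmetric] grid_point_square .
    then show "F s (Suc t) + F (Suc s) t \<le> F s t + F (Suc s) (Suc t)"
      using st by (simp add: F)
  qed
  then have "f (?P 0 (nat \<alpha>)) + f (?P (nat \<alpha>) 0) \<le> f (?P 0 0) + f (?P (nat \<alpha>) (nat \<alpha>))"
    by (simp add: F)
  then show ?thesis
    using \<open>\<alpha> \<ge> 0\<close>
    by (simp add: dmc_ineq_def scaled_def grid_point_corners flip: up_mid_def down_mid_def)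
qed

text \<open>The scaled rounded midpoints are the off-diagonal corners of the grid.\<close>

lemma dmc_set_effective_dom_scaled:
  fixes f :: "int ^ 'n \<Rightarrow> ereal"
  assumes "dmc_set (effective_dom f)" "\<alpha> \<ge> 0"
  shows "dmc_set (effective_dom (scaled \<alpha> f))"
proof -
  have mem: "x \<in> effective_dom (scaled \<alpha> f) \<longleftrightarrow> \<alpha> *s x \<in> effective_dom f" for x
    by (simp add: effective_dom_def scaled_def)
  show ?thesis
    unfolding dmc_set_def up_mid_def[symmetric] down_mid_def[symmetric] mem
    using dmc_set_grid[OF assms, of _ _ 0 "nat \<alpha>"] dmc_set_grid[OF assms, of _ _ "nat \<alpha>" 0]
    by (auto simp: grid_point_corners assms(2) mem)
qed

text \<open>Global convexity says nothing about the domain explicitly, but an infinite value at a rounded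
  midpoint would violate the inequality; the other summand cannot compensate, as it is not
  \<open>-\<infinity>\<close>.\<close>

lemma globally_dmc_imp_dmc_set:
  fixes f :: "int ^ 'n \<Rightarrow> ereal"
  assumes not_MInf: "\<And>x. f x \<noteq> -\<infinity>" and "globally_dmc f"
  shows "dmc_set (effective_dom f)"
  unfolding dmc_set_def up_mid_def[symmetric] down_mid_def[symmetric]
proof (intro ballI impI)
  fix x y assume "x \<in> effective_dom f" "y \<in> effective_dom f" "2 \<le> linf_dist x y"
  then have "f (up_mid x y) + f (down_mid x y) \<le> f x + f y" "f x + f y < \<infinity>"
    using \<open>globally_dmc f\<close>
    by (auto simp: globally_dmc_def dmc_ineq_def effective_dom_def up_mid_def down_mid_def)
  then have "f (up_mid x y) + f (down_mid x y) < \<infinity>"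
    by (rule order.strict_trans1)
  then show "up_mid x y \<in> effective_dom f \<and> down_mid x y \<in> effective_dom f"
    using not_MInf by (auto simp: effective_dom_def)
qed

theorem theorem4p2:
  fixes f :: "int ^ 'n \<Rightarrow> ereal" and \<alpha> :: int
  assumes "\<And>x. f x \<noteq> -\<infinity>" and "\<alpha> > 0"
  shows "(globally_dmc f \<longrightarrow> globally_dmc (scaled \<alpha> f)) \<and>
         (locally_dmc f \<longrightarrow> locally_dmc (scaled \<alpha> f))"
proof (intro conjI impI)
  have \<alpha>: "\<alpha> \<ge> 0"
    using assms(2) by simp
  {
    assume f: "globally_dmc f"
    show "globally_dmc (scaled \<alpha> f)"
      unfolding globally_dmc_def
    proof (intro allI impI)
      fix x y :: "int ^ 'n" assume "2 \<le> linf_dist x y"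
      then show "dmc_ineq (scaled \<alpha> f) x y"
        using f by (intro dmc_ineq_scaled assms(1) \<alpha> globally_dmc_imp_dmc_set)
          (auto simp: globally_dmc_def)
    qed
  next
    assume f: "locally_dmc f"
    then have dom: "dmc_set (effective_dom f)"
      by (simp add: locally_dmc_def)
    show "locally_dmc (scaled \<alpha> f)"
      unfolding locally_dmc_def
    proof (intro conjI allI impI)
      show "dmc_set (effective_dom (scaled \<alpha> f))"
        using dom \<alpha> by (rule dmc_set_effective_dom_scaled)
      fix x y :: "int ^ 'n" assume "linf_dist x y = 2"
      then show "dmc_ineq (scaled \<alpha> f) x y"
        using f by (intro dmc_ineq_scaled assms(1) \<alpha> dom) (auto simp: locally_dmc_def)
    qed
  }
qed

end
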